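(* Let $h$ and $k$ be arbitrary integers (positive or negative). Then there exist infinitely many integers $n$ such that each of the three integers $n$, $n+h$ and $n+k$ can be written in the form $a^2+b^2$ with $a,b$ nonzero integers. *)

theory Defs
  imports "HOL-Number_Theory.Number_Theory"
begin

definition sum_of_two_nonzero_squares :: "int \<Rightarrow> bool" where
  "sum_of_two_nonzero_squares m \<longleftrightarrow>
     (\<exists>a b :: int. a \<noteq> 0 \<and> b \<noteq> 0 \<and> m = a\<^sup>2 + b\<^sup>2)"

end

theory Submission
  imports Defs
begin

text \<open>
  Look for \<open>n = a\<^sup>2 + c\<^sup>2\<close>, \<open>n + h = (a + s)\<^sup>2 + (c + t)\<^sup>2\<close>, \<open>n + k = (a + u)\<^sup>2 + (c + v)\<^sup>2\<close>.
  For fixed shifts this is a linear system in \<open>a, c\<close> with determinant \<open>s v - t u\<close>. If \<open>h\<close> is odd,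
  the shifts \<open>(s, t) = (1, -2)\<close> and \<open>v = -1 - 2u\<close> make it unimodular, and it has an integral
  solution for every \<open>u\<close> with \<open>u \<equiv> k + 1 (mod 2)\<close>, with \<open>a \<approx> 5 u\<^sup>2\<close> and \<open>c \<approx> 5 u\<^sup>2 / 2\<close>.
  If \<open>h\<close> and \<open>k\<close> are both even, halve them and use that doubling preserves sums of two squares.
\<close>

text \<open>
  Unlike \<^const>\<open>sum_of_two_nonzero_squares\<close>, which contains \<open>2 = 1\<^sup>2 + 1\<^sup>2\<close> but not \<open>4\<close>,
  the following property is preserved by doubling.
\<close>

definition sum_of_two_distinct_pos_squares :: "int \<Rightarrow> bool" where
  "sum_of_two_distinct_pos_squares m \<longleftrightarrow> (\<exists>a b. 0 < b \<and> b < a \<and> m = a\<^sup>2 + b\<^sup>2)"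

lemma sum_of_two_distinct_pos_squaresI:
  "0 < b \<Longrightarrow> b < a \<Longrightarrow> m = a\<^sup>2 + b\<^sup>2 \<Longrightarrow> sum_of_two_distinct_pos_squares m"
  unfolding sum_of_two_distinct_pos_squares_def by blast

lemma sum_of_two_distinct_pos_squares_imp_nonzero:
  assumes "sum_of_two_distinct_pos_squares m"
  shows "sum_of_two_nonzero_squares m"
proof -
  obtain a b where "0 < b" "b < a" "m = a\<^sup>2 + b\<^sup>2"
    using assms unfolding sum_of_two_distinct_pos_squares_def by blast
  then show ?thesis
    unfolding sum_of_two_nonzero_squares_def by (intro exI[of _ a] exI[of _ b]) auto
qed

text \<open>Since \<open>(a - b)\<^sup>2 + (a + b)\<^sup>2 = 2 * (a\<^sup>2 + b\<^sup>2)\<close>: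
  \<open>b < a\<close> keeps \<open>a - b\<close> positive, and \<open>0 < b\<close> keeps the new
  roots distinct.\<close>

lemma sum_of_two_distinct_pos_squares_double:
  assumes "sum_of_two_distinct_pos_squares m"
  shows "sum_of_two_distinct_pos_squares (2 * m)"
proof -
  obtain a b where "0 < b" "b < a" "m = a\<^sup>2 + b\<^sup>2"
    using assms unfolding sum_of_two_distinct_pos_squares_def by blast
  then show ?thesis
    by (intro sum_of_two_distinct_pos_squaresI[of "a - b" "a + b"])
       (auto simp: power2_eq_square algebra_simps)
qed

lemma sum_of_two_distinct_pos_squares_triple_odd:
  fixes h k N :: int
  assumes "odd h"
  shows "\<exists>n\<ge>N. sum_of_two_distinct_pos_squares n \<and>
               sum_of_two_distinct_pos_squares (n + h) \<and>
               sum_of_two_distinct_pos_squares (n + k)"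
proof -
  obtain r where h: "h = 2 * r + 1"
    using assms by (elim oddE)
  define M where "M = \<bar>r\<bar> + \<bar>k\<bar> + \<bar>N\<bar> + 10"
  \<comment> \<open>The summand \<open>k + 1\<close> sets the parity that makes \<open>c\<close>
    below integral; the large offset lets \<open>u\<^sup>2\<close> dominate all terms in
    \<open>r\<close>, \<open>k\<close> and \<open>N\<close>.\<close>
  define u where "u = k + 1 + 2 * (10 * M)"
  have M: "M \<ge> 10" "\<bar>r\<bar> \<le> M" "\<bar>k\<bar> \<le> M" "N \<le> M"
    unfolding M_def by linarith+
  then have u_ge: "u \<ge> 10 * M"
    unfolding u_def by linarith
  \<comment> \<open>The equation for \<open>h\<close> forces \<open>a = r - 2 + 2 * c\<close>;
    substituted into the equation for \<open>k\<close>, it cancels the \<open>u * c\<close> terms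
    and leaves this value for \<open>2 * c\<close>.\<close>
  have "even (5 * u\<^sup>2 + 2 * u * r + 1 - k)"
    by (simp add: u_def)
  then obtain c where c: "5 * u\<^sup>2 + 2 * u * r + 1 - k = 2 * c"
    by (elim evenE)
  define a where "a = r - 2 + 2 * c"
  have ur: "10 * \<bar>u * r\<bar> \<le> u\<^sup>2"
  proof -
    have "u * (10 * \<bar>r\<bar>) \<le> u * u"
      using u_ge M by (intro mult_left_mono) linarith+
    then show ?thesis
      using u_ge M by (simp add: abs_mult power2_eq_square)
  qed
  have uu: "100 * u \<le> u\<^sup>2"
    using u_ge M by (simp add: power2_eq_square)
  have c_bounds: "2 * u\<^sup>2 \<le> c" "c \<le> 3 * u\<^sup>2"
    using c ur uu u_ge M by linarith+
  have "0 < c" "c < a"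
    using c_bounds a_def u_ge M uu by linarith+
  then have "sum_of_two_distinct_pos_squares (a\<^sup>2 + c\<^sup>2)"
    by (intro sum_of_two_distinct_pos_squaresI) auto
  moreover have "sum_of_two_distinct_pos_squares (a\<^sup>2 + c\<^sup>2 + h)"
  proof (rule sum_of_two_distinct_pos_squaresI)
    show "0 < c - 2" "c - 2 < a + 1"
      using c_bounds a_def u_ge M uu by linarith+
    show "a\<^sup>2 + c\<^sup>2 + h = (a + 1)\<^sup>2 + (c - 2)\<^sup>2"
      by (simp add: a_def h power2_eq_square algebra_simps)
  qed
  moreover have "sum_of_two_distinct_pos_squares (a\<^sup>2 + c\<^sup>2 + k)"
  proof (rule sum_of_two_distinct_pos_squaresI)
    show "0 < c - 1 - 2 * u" "c - 1 - 2 * u < a + u"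
      using c_bounds a_def u_ge M uu by linarith+
    have k: "k = 5 * u\<^sup>2 + 2 * u * r + 1 - 2 * c"
      using c by linarith
    show "a\<^sup>2 + c\<^sup>2 + k = (a + u)\<^sup>2 + (c - 1 - 2 * u)\<^sup>2"
      unfolding k a_def by (simp add: power2_eq_square algebra_simps)
  qed
  moreover have "N \<le> a\<^sup>2 + c\<^sup>2"
  proof -
    have "c \<le> c\<^sup>2"
      using \<open>0 < c\<close> by (simp add: power2_eq_square)
    then show ?thesis
      using c_bounds uu u_ge M zero_le_power2[of a] by linarith
  qed
  ultimately show ?thesis by blast
qed

lemma sum_of_two_distinct_pos_squares_triple:
  fixes h k N :: int
  shows "\<exists>n\<ge>N. sum_of_two_distinct_pos_squares n \<and>
               sum_of_two_distinct_pos_squares (n + h) \<and>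
               sum_of_two_distinct_pos_squares (n + k)"
proof (induction "nat (\<bar>h\<bar> + \<bar>k\<bar>)" arbitrary: h k N rule: less_induct)
  case less
  consider "odd h" | "odd k" | "h = 0" "k = 0" | "even h" "even k" "h \<noteq> 0 \<or> k \<noteq> 0"
    by blast
  then show ?case
  proof cases
    case 1
    then show ?thesis by (rule sum_of_two_distinct_pos_squares_triple_odd)
  next
    case 2
    then show ?thesis using sum_of_two_distinct_pos_squares_triple_odd[of k N h] by blast
  next
    case 3
    \<comment> \<open>Halving makes no progress here, but any odd instance supplies
      \<open>n\<close>.\<close>
    then show ?thesis using sum_of_two_distinct_pos_squares_triple_odd[of 1 N 1] by auto
  next
    case 4
    then obtain h' k' where hk: "h = 2 * h'" "k = 2 * k'"
      by (elim evenE)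
    have "nat (\<bar>h'\<bar> + \<bar>k'\<bar>) < nat (\<bar>h\<bar> + \<bar>k\<bar>)"
      using 4 hk by auto
    \<comment> \<open>The bound \<open>\<bar>N\<bar>\<close> ensures \<open>2 * n \<ge> N\<close>
      for negative \<open>N\<close> too.\<close>
    then obtain n where n: "n \<ge> \<bar>N\<bar>" "sum_of_two_distinct_pos_squares n"
      "sum_of_two_distinct_pos_squares (n + h')" "sum_of_two_distinct_pos_squares (n + k')"
      using less by blast
    have "2 * n \<ge> N"
      using n(1) by linarith
    then show ?thesis
      using n(2-4)[THEN sum_of_two_distinct_pos_squares_double] hk
      by (auto simp: algebra_simps)
  qed
qed

theorem theorem2p1:
  fixes h k :: int
  shows "infinite {n :: int. sum_of_two_nonzero_squares n \<and>
                             sum_of_two_nonzero_squares (n + h) \<and>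
                             sum_of_two_nonzero_squares (n + k)}"
    (is "infinite ?S")
proof
  assume "finite ?S"
  then have "bdd_above ?S" by simp
  then obtain B where B: "\<forall>n\<in>?S. n \<le> B"
    unfolding bdd_above_def by blast
  obtain n where "n \<ge> B + 1" "n \<in> ?S"
    using sum_of_two_distinct_pos_squares_triple[of "B + 1" h k]
      sum_of_two_distinct_pos_squares_imp_nonzero by blast
  then show False using B by force
qed

end
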